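(* Let $BES=\langle\mathcal{B},\mathcal{R}\rangle$ be a Boolean evolution system with unknown variables $b_1,\dots,b_{n_1}$ and known variables $b_{n_1+1},\dots,b_n$, and let $\mathcal{M}$ be its transition system. The stability problem can be checked by the CTL formula $$AF\Big(\bigwedge_{i=1}^{n_1}(AG\,\mathtt{B}_i\lor AG\,\mathtt{D}_i\lor AG\,\mathtt{K}_i)\ \land\bigwedge_{i=n_1+1}^{n}(AG\,\mathtt{B}_i\lor AG\,\mathtt{D}_i)\Big)$$ or the LTL formula $$\Diamond\Big(\bigwedge_{i=1}^{n_1}(\Box\mathtt{B}_i\lor\Box\mathtt{D}_i\lor\Box\mathtt{K}_i)\ \land\bigwedge_{i=n_1+1}^{n}(\Box\mathtt{B}_i\lor\Box\mathtt{D}_i)\Big),$$ that is, for each of these two formulas, the formula holds in $\mathcal{M}$ (at all initial states) if and only if $BES$ is stable.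
   Context: A Boolean evolution system $BES=\langle\mathcal{B},\mathcal{R}\rangle$ consists of a finite set of variables $\mathcal{B}=\{b_1,\dots,b_n\}$, $n=n_1+n_2$, with $\mathcal{B}^{unknown}=\{b_1,\dots,b_{n_1}\}$ and $\mathcal{B}^{known}=\{b_{n_1+1},\dots,b_{n_1+n_2}\}$, and a finite set $\mathcal{R}$ of rules, each of the form $g\to b$ (assign $true$ to $b$) or $g\to\neg b$ (assign $false$ to $b$), where $g$ (the guard) is a Boolean formula over $\mathcal{B}$ and $b\in\mathcal{B}$. A valuation gives each known variable a value in $\{true,false\}$ and each unknown variable a value in $\{true,false,unknown\}$. Guards are evaluated to $true$, $false$ or $unknown$ (strong Kleene three-valued logic); a rule is enabled at a valuation if its guard evaluates to $true$. It is assumed that at each valuation the set of enabled rules is non-empty. The transition system $\mathcal{M}=\langle S,S_0,T,A,H\rangle$ of $BES$: $S$ is the set of all $3^{n_1}\cdot 2^{n_2}$ valuations; $S_0$ is the set of the $2^{n_2}$ valuations in which all unknown variables have value $unknown$; $(s,s')\in T$ iff $s'$ results from $s$ by simultaneously applying all enabled rules (synchronous semantics): for each variable $b$, $s'(b)=s(b)$ if no enabled rule assigns $b$; $s'(b)=true$ (resp. $false$) if some enabled rule is of the form $g\to b$ (resp. $g\to\neg b$) and no enabled rule assigns the opposite value; and if enabled rules of both forms exist for $b$, then $s'(b)$ may be either $true$ or $false$ (so $k$ conflicting variables give $2^k$ successors). Atomic propositions: $\mathtt{B}_i$ holds in $s$ iff $s(b_i)=true$; $\mathtt{D}_i$ holds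 in $s$ iff $s(b_i)=false$; for $1\le i\le n_1$, $\mathtt{K}_i$ holds in $s$ iff $s(b_i)=unknown$. $H(s)$ is the set of atomic propositions valid in $s$. Stability: a valuation is stable if no other valuation can be obtained from it (its only successor is itself); $BES$ is stable if from any initial valuation (element of $S_0$), applying the rules recursively, it always eventually reaches a stable valuation (every path from an initial state reaches a stable valuation). CTL has the standard semantics. Satisfaction of LTL at a state is defined in the paper recursively by: $s\models p$ iff $p\in H(s)$; $s\models\neg\varphi$ iff not $s\models\varphi$; $s\models\varphi_1\land\varphi_2$ iff both hold at $s$ (and $\lor$ is the usual abbreviation); $s\models\bigcirc\varphi$ (resp. $\Box\varphi$, $\Diamond\varphi$) iff for all paths $\rho$ starting at $s$, $\rho(1)\models\varphi$ (resp. $\rho(i)\models\varphi$ for all $i\ge 0$; there exists $i\ge0$ with $\rho(i)\models\varphi$). Paths are infinite sequences of states with consecutive states related by $T$. A formula holds in $\mathcal{M}$ if it is satisfied at every state of $S_0$. *)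

theory Defs
  imports Main "HOL-Library.FuncSet"
begin

section \<open>Three-valued logic and guards\<close>

datatype tv = Tru | Fls | Unk

primrec tv_of_bool :: "bool \<Rightarrow> tv" where
  "tv_of_bool True = Tru"
| "tv_of_bool False = Fls"

fun tv_not :: "tv \<Rightarrow> tv" where
  "tv_not Tru = Fls"
| "tv_not Fls = Tru"
| "tv_not Unk = Unk"

fun tv_and :: "tv \<Rightarrow> tv \<Rightarrow> tv" where
  "tv_and Fls _ = Fls"
| "tv_and _ Fls = Fls"
| "tv_and Tru Tru = Tru"
| "tv_and _ _ = Unk"

fun tv_or :: "tv \<Rightarrow> tv \<Rightarrow> tv" where
  "tv_or Tru _ = Tru"
| "tv_or _ Tru = Tru"
| "tv_or Fls Fls = Fls"
| "tv_or _ _ = Unk"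

type_synonym valuation = "nat \<Rightarrow> tv"

datatype bexp =
    BConst bool
  | BVar nat
  | BNot bexp
  | BAnd bexp bexp
  | BOr bexp bexp

primrec bvars :: "bexp \<Rightarrow> nat set" where
  "bvars (BConst c) = {}"
| "bvars (BVar i) = {i}"
| "bvars (BNot g) = bvars g"
| "bvars (BAnd g h) = bvars g \<union> bvars h"
| "bvars (BOr g h) = bvars g \<union> bvars h"

primrec beval :: "bexp \<Rightarrow> valuation \<Rightarrow> tv" where
  "beval (BConst c) s = tv_of_bool c"
| "beval (BVar i) s = s i"
| "beval (BNot g) s = tv_not (beval g s)"
| "beval (BAnd g h) s = tv_and (beval g s) (beval h s)"
| "beval (BOr g h) s = tv_or (beval g s) (beval h s)"


section \<open>Boolean evolution systems\<close>

text \<open>\<open>Rule g i True\<close> is the rule $g \to b_i$ and \<open>Rule g i False\<close> is $g \to \neg b_i$.\<close>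

datatype rule = Rule (guard: bexp) (target: nat) (assigned_value: bool)

text \<open>
  The variable $b_i$ is represented by its index \<open>i\<close>: the unknown variables are
  \<open>{1..n_unknown E}\<close> and the known ones \<open>{n_unknown E + 1..n_vars E}\<close>.
\<close>

record bes =
  n_unknown :: nat
  n_known :: nat
  rules :: "rule set"

definition n_vars :: "bes \<Rightarrow> nat" where
  "n_vars E = n_unknown E + n_known E"

text \<open>
  Valuations are \<open>undefined\<close> outside the index set, so that each valuation of the
  variables is represented by exactly one function.
\<close>

definition valuations :: "bes \<Rightarrow> valuation set" where
  "valuations E =
     (\<Pi>\<^sub>E i\<in>{1..n_vars E}. if i \<le> n_unknown E then {Tru, Fls, Unk} else {Tru, Fls})"

definition initial_valuations :: "bes \<Rightarrow> valuation set" where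
  "initial_valuations E = {s \<in> valuations E. \<forall>i\<in>{1..n_unknown E}. s i = Unk}"

definition enabled :: "bes \<Rightarrow> valuation \<Rightarrow> rule set" where
  "enabled E s = {r \<in> rules E. beval (guard r) s = Tru}"

definition wf_bes :: "bes \<Rightarrow> bool" where
  "wf_bes E \<longleftrightarrow>
     finite (rules E) \<and>
     (\<forall>r\<in>rules E. bvars (guard r) \<subseteq> {1..n_vars E} \<and> target r \<in> {1..n_vars E}) \<and>
     (\<forall>s\<in>valuations E. enabled E s \<noteq> {})"

definition assigned :: "bes \<Rightarrow> valuation \<Rightarrow> nat \<Rightarrow> bool set" where
  "assigned E s i = {v. \<exists>g. Rule g i v \<in> enabled E s}"

text \<open>
  If \<open>assigned E s i\<close> contains both Boolean values, the enabled rules conflict on $b_i$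
  and either value may be taken, independently of the other variables.
\<close>

definition step :: "bes \<Rightarrow> (valuation \<times> valuation) set" where
  "step E = {(s, s'). s \<in> valuations E \<and> s' \<in> valuations E \<and>
     (\<forall>i\<in>{1..n_vars E}.
        s' i \<in> (if assigned E s i = {} then {s i} else tv_of_bool ` assigned E s i))}"


section \<open>Transition systems and paths\<close>

record ('s, 'p) ts =
  states :: "'s set"
  init :: "'s set"
  trans_rel :: "('s \<times> 's) set"
  props :: "'p set"
  labels :: "'s \<Rightarrow> 'p set"

definition paths :: "('s, 'p) ts \<Rightarrow> 's \<Rightarrow> (nat \<Rightarrow> 's) set" where
  "paths M s = {\<rho>. \<rho> 0 = s \<and> (\<forall>i. (\<rho> i, \<rho> (Suc i)) \<in> trans_rel M)}"

datatype ap = AP_B nat | AP_D nat | AP_K nat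

primrec ap_valid :: "valuation \<Rightarrow> ap \<Rightarrow> bool" where
  "ap_valid s (AP_B i) \<longleftrightarrow> s i = Tru"
| "ap_valid s (AP_D i) \<longleftrightarrow> s i = Fls"
| "ap_valid s (AP_K i) \<longleftrightarrow> s i = Unk"

definition bes_props :: "bes \<Rightarrow> ap set" where
  "bes_props E = AP_B ` {1..n_vars E} \<union> AP_D ` {1..n_vars E} \<union> AP_K ` {1..n_unknown E}"

definition bes_ts :: "bes \<Rightarrow> (valuation, ap) ts" where
  "bes_ts E =
     \<lparr>states = valuations E,
      init = initial_valuations E,
      trans_rel = step E,
      props = bes_props E,
      labels = (\<lambda>s. {p \<in> bes_props E. ap_valid s p})\<rparr>"

definition stable_valuation :: "bes \<Rightarrow> valuation \<Rightarrow> bool" where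
  "stable_valuation E s \<longleftrightarrow> (\<forall>s'. (s, s') \<in> step E \<longrightarrow> s' = s)"

definition bes_stable :: "bes \<Rightarrow> bool" where
  "bes_stable E \<longleftrightarrow>
     (\<forall>s\<in>initial_valuations E. \<forall>\<rho>\<in>paths (bes_ts E) s. \<exists>i. stable_valuation E (\<rho> i))"


section \<open>CTL\<close>

datatype 'p ctl =
    CTrue
  | CProp 'p
  | CNot "'p ctl"
  | CAnd "'p ctl" "'p ctl"
  | COr "'p ctl" "'p ctl"
  | CAX "'p ctl"
  | CEX "'p ctl"
  | CAF "'p ctl"
  | CEF "'p ctl"
  | CAG "'p ctl"
  | CEG "'p ctl"
  | CAU "'p ctl" "'p ctl"
  | CEU "'p ctl" "'p ctl"

primrec ctl_sat :: "('s, 'p) ts \<Rightarrow> 'p ctl \<Rightarrow> 's \<Rightarrow> bool" where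
  "ctl_sat M CTrue s \<longleftrightarrow> True"
| "ctl_sat M (CProp p) s \<longleftrightarrow> p \<in> labels M s"
| "ctl_sat M (CNot \<phi>) s \<longleftrightarrow> \<not> ctl_sat M \<phi> s"
| "ctl_sat M (CAnd \<phi> \<psi>) s \<longleftrightarrow> ctl_sat M \<phi> s \<and> ctl_sat M \<psi> s"
| "ctl_sat M (COr \<phi> \<psi>) s \<longleftrightarrow> ctl_sat M \<phi> s \<or> ctl_sat M \<psi> s"
| "ctl_sat M (CAX \<phi>) s \<longleftrightarrow> (\<forall>\<rho>\<in>paths M s. ctl_sat M \<phi> (\<rho> 1))"
| "ctl_sat M (CEX \<phi>) s \<longleftrightarrow> (\<exists>\<rho>\<in>paths M s. ctl_sat M \<phi> (\<rho> 1))"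
| "ctl_sat M (CAF \<phi>) s \<longleftrightarrow> (\<forall>\<rho>\<in>paths M s. \<exists>i. ctl_sat M \<phi> (\<rho> i))"
| "ctl_sat M (CEF \<phi>) s \<longleftrightarrow> (\<exists>\<rho>\<in>paths M s. \<exists>i. ctl_sat M \<phi> (\<rho> i))"
| "ctl_sat M (CAG \<phi>) s \<longleftrightarrow> (\<forall>\<rho>\<in>paths M s. \<forall>i. ctl_sat M \<phi> (\<rho> i))"
| "ctl_sat M (CEG \<phi>) s \<longleftrightarrow> (\<exists>\<rho>\<in>paths M s. \<forall>i. ctl_sat M \<phi> (\<rho> i))"
| "ctl_sat M (CAU \<phi> \<psi>) s \<longleftrightarrow>
     (\<forall>\<rho>\<in>paths M s. \<exists>i. ctl_sat M \<psi> (\<rho> i) \<and> (\<forall>j<i. ctl_sat M \<phi> (\<rho> j)))"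
| "ctl_sat M (CEU \<phi> \<psi>) s \<longleftrightarrow>
     (\<exists>\<rho>\<in>paths M s. \<exists>i. ctl_sat M \<psi> (\<rho> i) \<and> (\<forall>j<i. ctl_sat M \<phi> (\<rho> j)))"

definition CConj :: "'p ctl list \<Rightarrow> 'p ctl" where
  "CConj \<phi>s = foldr CAnd \<phi>s CTrue"

definition ctl_holds :: "('s, 'p) ts \<Rightarrow> 'p ctl \<Rightarrow> bool" where
  "ctl_holds M \<phi> \<longleftrightarrow> (\<forall>s\<in>init M. ctl_sat M \<phi> s)"


section \<open>LTL\<close>

text \<open>
  Satisfaction is defined at states, and every temporal operator, also a nested one,
  quantifies over all paths that start at the current state.  This differs from the usual
  semantics, in which a whole formula is evaluated along one fixed path, and the difference
  matters: along the constant path that keeps repeating a conflicting valuation which is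
  one of its own successors, every variable is constant, although the valuation is not stable.
\<close>

datatype 'p ltl =
    LTrue
  | LProp 'p
  | LNot "'p ltl"
  | LAnd "'p ltl" "'p ltl"
  | Next "'p ltl"
  | Always "'p ltl"
  | Eventually "'p ltl"

primrec ltl_sat :: "('s, 'p) ts \<Rightarrow> 'p ltl \<Rightarrow> 's \<Rightarrow> bool" where
  "ltl_sat M LTrue s \<longleftrightarrow> True"
| "ltl_sat M (LProp p) s \<longleftrightarrow> p \<in> labels M s"
| "ltl_sat M (LNot \<phi>) s \<longleftrightarrow> \<not> ltl_sat M \<phi> s"
| "ltl_sat M (LAnd \<phi> \<psi>) s \<longleftrightarrow> ltl_sat M \<phi> s \<and> ltl_sat M \<psi> s"
| "ltl_sat M (Next \<phi>) s \<longleftrightarrow> (\<forall>\<rho>\<in>paths M s. ltl_sat M \<phi> (\<rho> 1))"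
| "ltl_sat M (Always \<phi>) s \<longleftrightarrow> (\<forall>\<rho>\<in>paths M s. \<forall>i. ltl_sat M \<phi> (\<rho> i))"
| "ltl_sat M (Eventually \<phi>) s \<longleftrightarrow> (\<forall>\<rho>\<in>paths M s. \<exists>i. ltl_sat M \<phi> (\<rho> i))"

definition LOr :: "'p ltl \<Rightarrow> 'p ltl \<Rightarrow> 'p ltl" where
  "LOr \<phi> \<psi> = LNot (LAnd (LNot \<phi>) (LNot \<psi>))"

definition LConj :: "'p ltl list \<Rightarrow> 'p ltl" where
  "LConj \<phi>s = foldr LAnd \<phi>s LTrue"

definition ltl_holds :: "('s, 'p) ts \<Rightarrow> 'p ltl \<Rightarrow> bool" where
  "ltl_holds M \<phi> \<longleftrightarrow> (\<forall>s\<in>init M. ltl_sat M \<phi> s)"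


section \<open>Sizes of the state sets\<close>

lemma card_valuations: "card (valuations E) = 3 ^ n_unknown E * 2 ^ n_known E"
proof -
  have split: "{1..n_vars E} = {1..n_unknown E} \<union> {n_unknown E + 1..n_vars E}"
    by (auto simp: n_vars_def)
  have "card (valuations E) =
      (\<Prod>i\<in>{1..n_vars E}. if i \<le> n_unknown E then 3 else (2::nat))"
    unfolding valuations_def by (subst card_PiE) (auto intro!: prod.cong)
  also have "\<dots> = (\<Prod>i\<in>{1..n_unknown E}. 3) * (\<Prod>i\<in>{n_unknown E + 1..n_vars E}. 2)"
    unfolding split by (subst prod.union_disjoint) (auto intro!: arg_cong2[where f = "(*)"] prod.cong)
  also have "\<dots> = 3 ^ n_unknown E * 2 ^ n_known E"
    by (simp add: n_vars_def)
  finally show ?thesis .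
qed

lemma card_initial_valuations: "card (initial_valuations E) = 2 ^ n_known E"
proof -
  have split: "{1..n_vars E} = {1..n_unknown E} \<union> {n_unknown E + 1..n_vars E}"
    by (auto simp: n_vars_def)
  have "initial_valuations E =
      (\<Pi>\<^sub>E i\<in>{1..n_vars E}. if i \<le> n_unknown E then {Unk} else {Tru, Fls})"
    unfolding initial_valuations_def valuations_def PiE_iff set_eq_iff
    by (auto simp: n_vars_def PiE_iff split: if_splits)
  then have "card (initial_valuations E) =
      (\<Prod>i\<in>{1..n_vars E}. if i \<le> n_unknown E then 1 else (2::nat))"
    by simp (subst card_PiE, auto intro!: prod.cong)
  also have "\<dots> = (\<Prod>i\<in>{1..n_unknown E}. 1) * (\<Prod>i\<in>{n_unknown E + 1..n_vars E}. 2)"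
    unfolding split by (subst prod.union_disjoint) (auto intro!: prod.cong)
  also have "\<dots> = 2 ^ n_known E"
    by (simp add: n_vars_def)
  finally show ?thesis .
qed

end

theory Submission
  imports Defs
begin

text \<open>
  Every valuation has a successor, so each transition out of a state starts an infinite path.
  Hence a state is stable iff every variable keeps a single value along all paths from it,
  and that is what the argument of the outer eventuality says in both logics: the
  nested LTL operators quantify over all paths, exactly like those of CTL.
\<close>

lemma ctl_sat_CConj: "ctl_sat M (CConj \<phi>s) s \<longleftrightarrow> (\<forall>\<phi>\<in>set \<phi>s. ctl_sat M \<phi> s)"
  by (induction \<phi>s) (auto simp: CConj_def)

lemma ltl_sat_LConj: "ltl_sat M (LConj \<phi>s) s \<longleftrightarrow> (\<forall>\<phi>\<in>set \<phi>s. ltl_sat M \<phi> s)"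
  by (induction \<phi>s) (auto simp: LConj_def)

lemma ltl_sat_LOr: "ltl_sat M (LOr \<phi> \<psi>) s \<longleftrightarrow> ltl_sat M \<phi> s \<or> ltl_sat M \<psi> s"
  by (simp add: LOr_def)

text \<open>Paths are infinite, so a single transition is visible to a path quantifier only if it
  can be prolonged forever. Iterating a choice of successors inside \<open>S\<close> does
  this.\<close>

lemma path_through_transition:
  assumes "(s, s') \<in> trans_rel M"
    and serial: "\<And>t. t \<in> S \<Longrightarrow> \<exists>t'\<in>S. (t, t') \<in> trans_rel M"
    and "s' \<in> S"
  shows "\<exists>\<rho>\<in>paths M s. \<rho> 1 = s'"
proof -
  obtain nxt where nxt: "\<And>t. t \<in> S \<Longrightarrow> nxt t \<in> S \<and> (t, nxt t) \<in> trans_rel M"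
    using serial by metis
  define \<rho> where "\<rho> i = (case i of 0 \<Rightarrow> s | Suc j \<Rightarrow> (nxt ^^ j) s')" for i
  have "(nxt ^^ j) s' \<in> S" for j
    using \<open>s' \<in> S\<close> nxt by (induction j) auto
  then have "\<rho> \<in> paths M s"
    using assms(1) nxt by (auto simp: paths_def \<rho>_def split: nat.split)
  moreover have "\<rho> 1 = s'"
    by (simp add: \<rho>_def)
  ultimately show ?thesis
    by blast
qed

lemma step_in_valuations: "(s, s') \<in> step E \<Longrightarrow> s \<in> valuations E \<and> s' \<in> valuations E"
  by (auto simp: step_def)

lemma step_serial:
  assumes "s \<in> valuations E"
  shows "\<exists>s'\<in>valuations E. (s, s') \<in> step E"
proof -
  \<comment> \<open>Conflicts are resolved by an arbitrary choice among the assigned values. Outside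
    the index set \<open>s'\<close> copies \<open>s\<close>, so it stays \<open>undefined\<close>
    there, as membership in \<open>valuations E\<close> requires.\<close>
  define s' where "s' i =
    (if i \<in> {1..n_vars E} \<and> assigned E s i \<noteq> {} then tv_of_bool (SOME v. v \<in> assigned E s i) else s i)" for i
  have "tv_of_bool v = Tru \<or> tv_of_bool v = Fls" for v
    by (cases v) auto
  then have "s' \<in> valuations E"
    using assms unfolding valuations_def PiE_iff s'_def by (auto simp: extensional_def)
  moreover have "(SOME v. v \<in> assigned E s i) \<in> assigned E s i" if "assigned E s i \<noteq> {}" for i
    using that by (simp add: some_in_eq)
  ultimately show ?thesis
    using assms by (intro bexI[of _ s']) (auto simp: step_def s'_def)
qed

lemma path_in_valuations:
  assumes "s \<in> valuations E" "\<rho> \<in> paths (bes_ts E) s"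
  shows "\<rho> k \<in> valuations E"
proof -
  have "(\<rho> k, \<rho> (Suc k)) \<in> step E"
    using assms(2) by (auto simp: paths_def bes_ts_def)
  then show ?thesis
    by (simp add: step_in_valuations)
qed

text \<open>Common semantic content of \<open>CAG\<close> and \<open>Always\<close> applied to an
  atomic proposition. Both halves of the theorem are reduced to this predicate.\<close>

definition constant_var :: "bes \<Rightarrow> valuation \<Rightarrow> nat \<Rightarrow> tv \<Rightarrow> bool" where
  "constant_var E s i v \<longleftrightarrow> (\<forall>\<rho>\<in>paths (bes_ts E) s. \<forall>k. \<rho> k i = v)"

lemma stable_valuation_path_constant:
  assumes "stable_valuation E s" "\<rho> \<in> paths (bes_ts E) s"
  shows "\<rho> k = s"
proof (induction k)
  case 0
  then show ?case
    using assms(2) by (simp add: paths_def)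
next
  case (Suc k)
  have "(\<rho> k, \<rho> (Suc k)) \<in> step E"
    using assms(2) by (simp add: paths_def bes_ts_def)
  then show ?case
    using Suc assms(1) by (auto simp: stable_valuation_def)
qed

text \<open>A stable valuation admits only the constant path. Conversely, each successor occurs at
  position 1 of some path, where constancy forces it to agree with \<open>s\<close>. If
  \<open>s\<close> is not in \<open>valuations E\<close>, it has no steps and no paths, and both
  sides hold vacuously.\<close>

lemma stable_valuation_iff_constant_var:
  "stable_valuation E s \<longleftrightarrow> (\<forall>i\<in>{1..n_vars E}. constant_var E s i (s i))"
proof
  assume "stable_valuation E s"
  then show "\<forall>i\<in>{1..n_vars E}. constant_var E s i (s i)"
    by (auto simp: constant_var_def dest: stable_valuation_path_constant)
next
  assume const: "\<forall>i\<in>{1..n_vars E}. constant_var E s i (s i)"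
  show "stable_valuation E s"
    unfolding stable_valuation_def
  proof (intro allI impI)
    fix s' assume st: "(s, s') \<in> step E"
    then have vals: "s \<in> valuations E" "s' \<in> valuations E"
      by (auto dest: step_in_valuations)
    obtain \<rho> where "\<rho> \<in> paths (bes_ts E) s" "\<rho> 1 = s'"
      using path_through_transition[where M = "bes_ts E" and S = "valuations E"] st vals step_serial
      by (fastforce simp: bes_ts_def)
    then have "s' i = s i" if "i \<in> {1..n_vars E}" for i
      using const that unfolding constant_var_def by metis
    \<comment> \<open>Valuations are extensional, so agreement on the index set is already
      equality.\<close>
    then show "s' = s"
      using vals PiE_ext unfolding valuations_def by blast
  qed
qed

text \<open>Without a path from \<open>s\<close>, \<open>constant_var\<close> would hold vacuously
  for every \<open>v\<close>. Seriality supplies a path, and its position 0 reads off the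
  value.\<close>

lemma constant_var_imp_value:
  assumes "s \<in> valuations E" "constant_var E s i v"
  shows "s i = v"
proof -
  obtain s' where "s' \<in> valuations E" "(s, s') \<in> step E"
    using step_serial[OF assms(1)] by blast
  then obtain \<rho> where "\<rho> \<in> paths (bes_ts E) s"
    using path_through_transition[where M = "bes_ts E" and S = "valuations E"] step_serial
    by (fastforce simp: bes_ts_def)
  moreover from this have "\<rho> 0 = s"
    by (simp add: paths_def)
  ultimately show ?thesis
    using assms(2) unfolding constant_var_def by blast
qed

text \<open>Only the current value can be the constant one, so stability amounts to a disjunction
  over the possible values; known variables never take \<open>Unk\<close>. The half-open intervals
  and the nesting of the disjunctions mirror the formulas of the theorem.\<close>

lemma stable_valuation_iff:
  assumes "s \<in> valuations E"
  shows "stable_valuation E s \<longleftrightarrow>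
    (\<forall>i\<in>{1..<n_unknown E + 1}.
       (constant_var E s i Tru \<or> constant_var E s i Fls) \<or> constant_var E s i Unk) \<and>
    (\<forall>i\<in>{n_unknown E + 1..<n_vars E + 1}. constant_var E s i Tru \<or> constant_var E s i Fls)"
    (is "_ \<longleftrightarrow> ?unknown \<and> ?known")
proof
  assume "stable_valuation E s"
  then have const: "constant_var E s i (s i)" if "i \<in> {1..n_vars E}" for i
    using that by (simp add: stable_valuation_iff_constant_var)
  have ?unknown
  proof
    fix i assume "i \<in> {1..<n_unknown E + 1}"
    then have "constant_var E s i (s i)"
      by (intro const) (auto simp: n_vars_def)
    then show "(constant_var E s i Tru \<or> constant_var E s i Fls) \<or> constant_var E s i Unk"
      by (cases "s i") auto
  qed
  moreover have ?known
  proof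
    fix i assume i: "i \<in> {n_unknown E + 1..<n_vars E + 1}"
    then have "s i \<in> {Tru, Fls}"
      using assms by (auto simp: valuations_def PiE_iff split: if_splits dest!: bspec[of _ _ i])
    moreover have "constant_var E s i (s i)"
      using i by (intro const) auto
    ultimately show "constant_var E s i Tru \<or> constant_var E s i Fls"
      by auto
  qed
  ultimately show "?unknown \<and> ?known" ..
next
  assume vars: "?unknown \<and> ?known"
  have "constant_var E s i (s i)" if "i \<in> {1..n_vars E}" for i
  proof -
    have "\<exists>v. constant_var E s i v"
      using vars that by (cases "i \<le> n_unknown E") fastforce+
    then show ?thesis
      using constant_var_imp_value[OF assms] by blast
  qed
  then show "stable_valuation E s"
    by (simp add: stable_valuation_iff_constant_var)
qed

lemma labels_bes_ts:
  "p \<in> labels (bes_ts E) s \<longleftrightarrow> p \<in> bes_props E \<and> ap_valid s p"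
  by (simp add: bes_ts_def)

lemma bes_props_iff:
  "AP_B i \<in> bes_props E \<longleftrightarrow> i \<in> {1..n_vars E}"
  "AP_D i \<in> bes_props E \<longleftrightarrow> i \<in> {1..n_vars E}"
  "AP_K i \<in> bes_props E \<longleftrightarrow> i \<in> {1..n_unknown E}"
  by (auto simp: bes_props_def)

text \<open>The index ranges matter because labels contain only members of
  \<open>bes_props E\<close>: for instance, \<open>AP_K i\<close> labels no state when
  \<open>i\<close> is a known variable.\<close>

lemma ctl_sat_constant_var:
  "i \<in> {1..n_vars E} \<Longrightarrow> ctl_sat (bes_ts E) (CAG (CProp (AP_B i))) s \<longleftrightarrow> constant_var E s i Tru"
  "i \<in> {1..n_vars E} \<Longrightarrow> ctl_sat (bes_ts E) (CAG (CProp (AP_D i))) s \<longleftrightarrow> constant_var E s i Fls"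
  "i \<in> {1..n_unknown E} \<Longrightarrow> ctl_sat (bes_ts E) (CAG (CProp (AP_K i))) s \<longleftrightarrow> constant_var E s i Unk"
  by (simp_all add: constant_var_def labels_bes_ts bes_props_iff)

lemma ltl_sat_constant_var:
  "i \<in> {1..n_vars E} \<Longrightarrow> ltl_sat (bes_ts E) (Always (LProp (AP_B i))) s \<longleftrightarrow> constant_var E s i Tru"
  "i \<in> {1..n_vars E} \<Longrightarrow> ltl_sat (bes_ts E) (Always (LProp (AP_D i))) s \<longleftrightarrow> constant_var E s i Fls"
  "i \<in> {1..n_unknown E} \<Longrightarrow> ltl_sat (bes_ts E) (Always (LProp (AP_K i))) s \<longleftrightarrow> constant_var E s i Unk"
  by (simp_all add: constant_var_def labels_bes_ts bes_props_iff)

theorem lemma3: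
  fixes E :: bes
  assumes "wf_bes E"
  shows
    "(ctl_holds (bes_ts E)
        (CAF (CAnd
          (CConj (map (\<lambda>i. COr (COr (CAG (CProp (AP_B i))) (CAG (CProp (AP_D i)))) (CAG (CProp (AP_K i))))
             [1..<n_unknown E + 1]))
          (CConj (map (\<lambda>i. COr (CAG (CProp (AP_B i))) (CAG (CProp (AP_D i))))
             [n_unknown E + 1..<n_vars E + 1]))))
      \<longleftrightarrow> bes_stable E) \<and>
     (ltl_holds (bes_ts E)
        (Eventually (LAnd
          (LConj (map (\<lambda>i. LOr (LOr (Always (LProp (AP_B i))) (Always (LProp (AP_D i)))) (Always (LProp (AP_K i))))
             [1..<n_unknown E + 1]))
          (LConj (map (\<lambda>i. LOr (Always (LProp (AP_B i))) (Always (LProp (AP_D i))))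
             [n_unknown E + 1..<n_vars E + 1]))))
      \<longleftrightarrow> bes_stable E)"
  (is "(ctl_holds _ (CAF ?\<phi>) \<longleftrightarrow> _) \<and> (ltl_holds _ (Eventually ?\<psi>) \<longleftrightarrow> _)")
proof -
  have unknown: "i \<in> {1..n_unknown E}" "i \<in> {1..n_vars E}" if "i \<in> {1..<n_unknown E + 1}" for i
    using that by (auto simp: n_vars_def)
  have known: "i \<in> {1..n_vars E}" if "i \<in> {n_unknown E + 1..<n_vars E + 1}" for i
    using that by auto
  \<comment> \<open>Restricted to valuations, since \<open>stable_valuation_iff\<close> relies on
    the value ranges of the variables.\<close>
  have ctl: "ctl_sat (bes_ts E) ?\<phi> s \<longleftrightarrow> stable_valuation E s" if "s \<in> valuations E" for s
    unfolding stable_valuation_iff[OF that] ctl_sat.simps(4,5) ctl_sat_CConj set_map set_upt ball_simps(9)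
    by (intro arg_cong2[where f = "(\<and>)"] ball_cong refl)
      (simp_all only: ctl_sat.simps(5) ctl_sat_constant_var unknown known)
  have ltl: "ltl_sat (bes_ts E) ?\<psi> s \<longleftrightarrow> stable_valuation E s" if "s \<in> valuations E" for s
    unfolding stable_valuation_iff[OF that] ltl_sat.simps(4) ltl_sat_LConj set_map set_upt ball_simps(9)
    by (intro arg_cong2[where f = "(\<and>)"] ball_cong refl)
      (simp_all only: ltl_sat_LOr ltl_sat_constant_var unknown known)
  have initial: "s \<in> valuations E" if "s \<in> initial_valuations E" for s
    using that by (simp add: initial_valuations_def)
  have init: "init (bes_ts E) = initial_valuations E"
    by (simp add: bes_ts_def)
  have "ctl_holds (bes_ts E) (CAF ?\<phi>) \<longleftrightarrow> bes_stable E"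
    unfolding ctl_holds_def init bes_stable_def ctl_sat.simps(8)
    \<comment> \<open>\<open>CAF\<close> and \<open>bes_stable\<close> quantify alike over paths and
      positions, so the arguments need only agree at each state of a path, which is a valuation by
      \<open>path_in_valuations\<close>.\<close>
    by (intro ball_cong refl ex_cong1 ctl path_in_valuations initial)
  moreover have "ltl_holds (bes_ts E) (Eventually ?\<psi>) \<longleftrightarrow> bes_stable E"
    unfolding ltl_holds_def init bes_stable_def ltl_sat.simps(7)
    by (intro ball_cong refl ex_cong1 ltl path_in_valuations initial)
  ultimately show ?thesis ..
qed

end
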